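(* Let $K=\mathbb{F}_q$ be a finite field, let $S=K[x_1,\dots,x_m]$ be the polynomial ring with the standard grading, and let $\mathfrak{m}=(x_1,\dots,x_m)$ be its homogeneous maximal ideal. Let $I\subset S$ be a homogeneous ideal such that $(I(\mathbb{P}^{m-1}):I)\neq I(\mathbb{P}^{m-1})$, and let $\mathbb{X}=V_{\mathbb{P}^{m-1}}(I)$. Then $$I(\mathbb{X})=(I+I(\mathbb{P}^{m-1})):\mathfrak{m}^\infty.$$
   Context: $\mathbb{P}^{m-1}$ denotes the finite set of $\mathbb{F}_q$-rational points of projective $(m-1)$-space over $K=\mathbb{F}_q$. For a homogeneous ideal $I\subset S$, $V_{\mathbb{P}^{m-1}}(I)\subset\mathbb{P}^{m-1}$ is the set of (rational) points at which all homogeneous polynomials of $I$ vanish. For a subset $\mathbb{X}\subset\mathbb{P}^{m-1}$, the vanishing ideal $I(\mathbb{X})\subset S$ is the homogeneous ideal generated by the homogeneous polynomials of $S$ that vanish at every point of $\mathbb{X}$. In particular $I(\mathbb{P}^{m-1})$ is the vanishing ideal of the set of all rational points, and it is known that $I(\mathbb{P}^{m-1})=\langle x_i^qx_j-x_ix_j^q : 1\leq i<j\leq m\rangle$. For ideals $A,B\subset S$, $(A:B)=\{f\in S : fB\subset A\}$ and $(A:B^\infty)=\bigcup_{k\geq 1}(A:B^k)$ (the saturation of $A$ with respect to $B$). *)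

theory Defs
  imports
    "HOL-Analysis.Finite_Cartesian_Product"
    "HOL-Library.Poly_Mapping"
    "HOL-Library.Set_Algebras"
begin

text \<open>
  The polynomial ring in \<open>m\<close> variables over \<open>'k\<close>, with \<open>m = CARD('n)\<close>: a polynomial is a finitely
  supported map from exponent vectors to coefficients, multiplied by convolution.
\<close>

type_synonym ('n, 'k) mpoly = "('n \<Rightarrow>\<^sub>0 nat) \<Rightarrow>\<^sub>0 'k"

definition var :: "'n \<Rightarrow> ('n, 'k::zero_neq_one) mpoly" where
  "var i = Poly_Mapping.single (Poly_Mapping.single i 1) 1"

definition mpoly_eval :: "'k::comm_ring_1 ^ 'n \<Rightarrow> ('n::finite, 'k) mpoly \<Rightarrow> 'k" where
  "mpoly_eval v f =
     (\<Sum>t\<in>Poly_Mapping.keys f. Poly_Mapping.lookup f t * (\<Prod>i\<in>UNIV. (v $ i) ^ Poly_Mapping.lookup t i))"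

definition monom_deg :: "('n::finite \<Rightarrow>\<^sub>0 nat) \<Rightarrow> nat" where
  "monom_deg t = (\<Sum>i\<in>UNIV. Poly_Mapping.lookup t i)"

text \<open>The zero polynomial is homogeneous of every degree.\<close>

definition homogeneous :: "('n::finite, 'k::zero) mpoly \<Rightarrow> bool" where
  "homogeneous f \<longleftrightarrow> (\<exists>d. \<forall>t\<in>Poly_Mapping.keys f. monom_deg t = d)"


text \<open>
  Ideals of a commutative ring are its submodules as a module over itself, so that
  \<open>ideal.span G\<close> is the ideal generated by \<open>G\<close>.
\<close>

global_interpretation ideal: module "(*) :: 'a::comm_ring_1 \<Rightarrow> 'a \<Rightarrow> 'a"
  by unfold_locales (simp_all add: algebra_simps)

abbreviation is_ideal :: "'a::comm_ring_1 set \<Rightarrow> bool" where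
  "is_ideal \<equiv> ideal.subspace"

abbreviation ideal_gen :: "'a::comm_ring_1 set \<Rightarrow> 'a set" where
  "ideal_gen \<equiv> ideal.span"

primrec ideal_power :: "'a::comm_ring_1 set \<Rightarrow> nat \<Rightarrow> 'a set" where
  "ideal_power B 0 = UNIV"
| "ideal_power B (Suc k) = ideal_gen {a * b | a b. a \<in> B \<and> b \<in> ideal_power B k}"

definition ideal_colon :: "'a::comm_ring_1 set \<Rightarrow> 'a set \<Rightarrow> 'a set" where
  "ideal_colon A B = {f. \<forall>b\<in>B. f * b \<in> A}"

definition saturation :: "'a::comm_ring_1 set \<Rightarrow> 'a set \<Rightarrow> 'a set" where
  "saturation A B = (\<Union>k\<in>{1..}. ideal_colon A (ideal_power B k))"

definition homogeneous_ideal :: "('n::finite, 'k::comm_ring_1) mpoly set \<Rightarrow> bool" where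
  "homogeneous_ideal I \<longleftrightarrow> is_ideal I \<and> (\<exists>G. (\<forall>g\<in>G. homogeneous g) \<and> I = ideal_gen G)"

definition max_ideal :: "('n::finite, 'k::comm_ring_1) mpoly set" where
  "max_ideal = ideal_gen (range var)"


text \<open>
  A rational point of projective \<open>(m - 1)\<close>-space is a class of nonzero vectors of \<open>'k ^ 'n\<close> modulo
  nonzero scalars. Whether a homogeneous polynomial vanishes at a point does not depend on the
  representative, so requiring it for all representatives is no restriction.
\<close>

definition proj_rel :: "('k::field ^ 'n) rel" where
  "proj_rel = {(v, w). v \<noteq> 0 \<and> w \<noteq> 0 \<and> (\<exists>c. c \<noteq> 0 \<and> w = c *s v)}"

definition proj_space :: "('k::field ^ 'n) set set" where
  "proj_space = (UNIV - {0}) // proj_rel"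

definition vanishes_at :: "('n::finite, 'k::field) mpoly \<Rightarrow> ('k ^ 'n) set \<Rightarrow> bool" where
  "vanishes_at f P \<longleftrightarrow> (\<forall>v\<in>P. mpoly_eval v f = 0)"

definition proj_zeros :: "('n::finite, 'k::field) mpoly set \<Rightarrow> ('k ^ 'n) set set" where
  "proj_zeros I = {P \<in> proj_space. \<forall>f\<in>I. homogeneous f \<longrightarrow> vanishes_at f P}"

definition vanishing_ideal :: "('k::field ^ 'n::finite) set set \<Rightarrow> ('n, 'k) mpoly set" where
  "vanishing_ideal X = ideal_gen {f. homogeneous f \<and> (\<forall>P\<in>X. vanishes_at f P)}"

lemma equiv_proj_rel: "equiv (UNIV - {0}) (proj_rel :: ('k::field ^ 'n) rel)"
proof (rule equivI)
  show "proj_rel \<subseteq> (UNIV - {0 :: 'k ^ 'n}) \<times> (UNIV - {0})"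
    by (auto simp: proj_rel_def)
  show "refl_on (UNIV - {0}) (proj_rel :: ('k ^ 'n) rel)"
  proof (rule refl_onI)
    fix v :: "'k ^ 'n"
    assume "v \<in> UNIV - {0}"
    moreover have "(1::'k) \<noteq> 0 \<and> v = 1 *s v"
      by simp
    ultimately show "(v, v) \<in> proj_rel"
      unfolding proj_rel_def by blast
  qed
  show "sym (proj_rel :: ('k ^ 'n) rel)"
  proof (rule symI)
    fix v w :: "'k ^ 'n"
    assume "(v, w) \<in> proj_rel"
    then obtain c where "v \<noteq> 0" "w \<noteq> 0" "c \<noteq> 0" "w = c *s v"
      unfolding proj_rel_def by blast
    then have "inverse c \<noteq> 0 \<and> v = inverse c *s w"
      by (simp add: vector_smult_assoc)
    with \<open>v \<noteq> 0\<close> \<open>w \<noteq> 0\<close> show "(w, v) \<in> proj_rel"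
      unfolding proj_rel_def by blast
  qed
  show "trans (proj_rel :: ('k ^ 'n) rel)"
  proof (rule transI)
    fix u v w :: "'k ^ 'n"
    assume "(u, v) \<in> proj_rel" "(v, w) \<in> proj_rel"
    then obtain c d where "u \<noteq> 0" "w \<noteq> 0" "c \<noteq> 0" "d \<noteq> 0" "v = c *s u" "w = d *s v"
      unfolding proj_rel_def by blast
    then have "d * c \<noteq> 0 \<and> w = (d * c) *s u"
      by (simp add: vector_smult_assoc)
    with \<open>u \<noteq> 0\<close> \<open>w \<noteq> 0\<close> show "(u, w) \<in> proj_rel"
      unfolding proj_rel_def by blast
  qed
qed

lemma mpoly_eval_scale:
  fixes f :: "('n::finite, 'k::field) mpoly"
  assumes "\<forall>t\<in>Poly_Mapping.keys f. monom_deg t = d"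
  shows "mpoly_eval (c *s v) f = c ^ d * mpoly_eval v f"
  unfolding mpoly_eval_def sum_distrib_left
proof (rule sum.cong)
  fix t
  assume "t \<in> Poly_Mapping.keys f"
  then have "(\<Prod>i\<in>UNIV. c ^ Poly_Mapping.lookup t i) = c ^ d"
    using assms by (simp add: monom_deg_def power_sum[symmetric])
  then have "(\<Prod>i\<in>UNIV. ((c *s v) $ i) ^ Poly_Mapping.lookup t i) =
      c ^ d * (\<Prod>i\<in>UNIV. (v $ i) ^ Poly_Mapping.lookup t i)"
    by (simp add: power_mult_distrib prod.distrib)
  then show "Poly_Mapping.lookup f t * (\<Prod>i\<in>UNIV. ((c *s v) $ i) ^ Poly_Mapping.lookup t i) =
      c ^ d * (Poly_Mapping.lookup f t * (\<Prod>i\<in>UNIV. (v $ i) ^ Poly_Mapping.lookup t i))"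
    by (simp only: mult.left_commute)
qed simp

end

theory Submission
  imports Defs "HOL-Computational_Algebra.Polynomial"
begin

text \<open>
  Restrict a polynomial \<open>f\<close> to the line through a vector \<open>v\<close>, that is, consider \<open>f(T v)\<close> in \<open>k[T]\<close>.
  This is a ring homomorphism into a domain whose coefficients are the values at \<open>v\<close> of the
  homogeneous components of \<open>f\<close>, so the vanishing ideal of a set of points is an intersection of
  kernels of such maps and is in particular saturated. Conversely, since there are only finitely
  many points, in every large degree there are forms in \<open>I\<close> that vanish at all points but one
  prescribed point outside \<open>X\<close>. Subtracting multiples of these from a form of large degree that
  vanishes on \<open>X\<close> leaves a form that vanishes at all rational points.
\<close>

section \<open>Restriction of polynomials to lines through the origin\<close>

text \<open>Forms of one fixed degree are closed under differences, which fails for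
  \<open>homogeneous\<close> with its hidden degree.\<close>

definition form_of_degree :: "nat \<Rightarrow> ('n::finite, 'k::zero) mpoly \<Rightarrow> bool" where
  "form_of_degree d f \<longleftrightarrow> (\<forall>t\<in>Poly_Mapping.keys f. monom_deg t = d)"

definition monom_eval :: "'k::comm_ring_1 ^ 'n \<Rightarrow> ('n::finite \<Rightarrow>\<^sub>0 nat) \<Rightarrow> 'k" where
  "monom_eval v t = (\<Prod>i\<in>UNIV. (v $ i) ^ Poly_Mapping.lookup t i)"

text \<open>The substitution of \<open>v $ i\<close> times T for the i-th variable. T is an
  indeterminate because scalars from a finite field do not separate homogeneous components: x^q - x
  vanishes on every scalar multiple of a vector over the field with q elements.\<close>

definition line_eval :: "'k::comm_ring_1 ^ 'n \<Rightarrow> ('n::finite, 'k) mpoly \<Rightarrow> 'k poly" where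
  "line_eval v f =
     (\<Sum>t\<in>Poly_Mapping.keys f. monom (Poly_Mapping.lookup f t * monom_eval v t) (monom_deg t))"

lemma poly_mapping_sum_single:
  "(\<Sum>t\<in>Poly_Mapping.keys f. Poly_Mapping.single t (Poly_Mapping.lookup f t)) = f"
  by (rule poly_mapping_eqI)
    (auto simp: lookup_sum lookup_single when_def in_keys_iff sum.delta)

lemma monom_deg_0 [simp]: "monom_deg 0 = 0"
  by (simp add: monom_deg_def)

lemma monom_deg_add: "monom_deg (s + t) = monom_deg s + monom_deg t"
  by (simp add: monom_deg_def lookup_add sum.distrib)

lemma monom_deg_single [simp]: "monom_deg (Poly_Mapping.single i a) = a"
  by (simp add: monom_deg_def lookup_single when_def)

lemma monom_eval_0 [simp]: "monom_eval v 0 = 1"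
  by (simp add: monom_eval_def)

lemma monom_eval_add: "monom_eval v (s + t) = monom_eval v s * monom_eval v t"
  by (simp add: monom_eval_def lookup_add power_add prod.distrib)

lemma monom_eval_single [simp]: "monom_eval v (Poly_Mapping.single i a) = (v $ i) ^ a"
  by (simp add: monom_eval_def lookup_single when_def if_distrib cong: if_cong)

lemma line_eval_0 [simp]: "line_eval v 0 = 0"
  by (simp add: line_eval_def)

lemma line_eval_single [simp]:
  "line_eval v (Poly_Mapping.single t a) = monom (a * monom_eval v t) (monom_deg t)"
  by (simp add: line_eval_def)

lemma line_eval_1 [simp]: "line_eval v 1 = 1"
  by (simp add: line_eval_def)

lemma line_eval_add: "line_eval v (f + g) = line_eval v f + line_eval v g"
  unfolding line_eval_def
  by (rule setsum_keys_plus_distrib) (simp_all add: distrib_right add_monom)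

lemma line_eval_sum: "line_eval v (sum f A) = (\<Sum>x\<in>A. line_eval v (f x))"
  by (induction A rule: infinite_finite_induct) (simp_all add: line_eval_add)

lemma line_eval_single_mult:
  "line_eval v (Poly_Mapping.single t a * Poly_Mapping.single u b) =
     line_eval v (Poly_Mapping.single t a) * line_eval v (Poly_Mapping.single u b)"
  by (simp only: mult_single line_eval_single monom_eval_add monom_deg_add mult_monom
      mult.commute mult.left_commute mult.assoc)

text \<open>Both sides are bilinear, so it suffices to compare single terms, where degrees add and
  monomial values multiply.\<close>

lemma line_eval_mult: "line_eval v (f * g) = line_eval v f * line_eval v g"
proof -
  let ?s = "\<lambda>f t. Poly_Mapping.single t (Poly_Mapping.lookup f t)"
  let ?F = "Poly_Mapping.keys f" and ?G = "Poly_Mapping.keys g"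
  have "line_eval v (f * g) = line_eval v ((\<Sum>t\<in>?F. ?s f t) * (\<Sum>u\<in>?G. ?s g u))"
    by (simp only: poly_mapping_sum_single)
  also have "\<dots> = (\<Sum>t\<in>?F. \<Sum>u\<in>?G. line_eval v (?s f t * ?s g u))"
    by (simp only: sum_product line_eval_sum)
  also have "\<dots> = (\<Sum>t\<in>?F. \<Sum>u\<in>?G. line_eval v (?s f t) * line_eval v (?s g u))"
    by (simp only: line_eval_single_mult)
  also have "\<dots> = (\<Sum>t\<in>?F. line_eval v (?s f t)) * (\<Sum>u\<in>?G. line_eval v (?s g u))"
    by (simp only: sum_product)
  also have "\<dots> = line_eval v f * line_eval v g"
    by (simp only: line_eval_sum[symmetric] poly_mapping_sum_single)
  finally show ?thesis .
qed

lemma line_eval_power: "line_eval v (f ^ k) = line_eval v f ^ k"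
  by (induction k) (simp_all add: line_eval_mult)

text \<open>Reduces the vanishing of a whole ideal on a line to that of its generators.\<close>

lemma subspace_line_eval_kernel: "is_ideal {f. line_eval v f = 0}"
  by (simp add: ideal.subspace_def line_eval_add line_eval_mult)

section \<open>Evaluation at vectors and homogeneous forms\<close>

lemma mpoly_eval_conv_line_eval: "mpoly_eval v f = poly (line_eval v f) 1"
  by (simp add: mpoly_eval_def line_eval_def poly_sum poly_monom monom_eval_def)

lemma line_eval_form:
  assumes "form_of_degree d f"
  shows "line_eval v f = monom (mpoly_eval v f) d"
proof -
  have "line_eval v f = (\<Sum>t\<in>Poly_Mapping.keys f. monom (Poly_Mapping.lookup f t * monom_eval v t) d)"
    using assms by (simp add: line_eval_def form_of_degree_def)
  then show ?thesis
    by (simp add: mpoly_eval_def monom_eval_def monom_sum)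
qed

lemma mpoly_eval_single [simp]: "mpoly_eval v (Poly_Mapping.single t a) = a * monom_eval v t"
  by (simp add: mpoly_eval_conv_line_eval poly_monom)

lemma mpoly_eval_var [simp]: "mpoly_eval v (var i) = v $ i"
  by (simp add: var_def)

lemma mpoly_eval_1 [simp]: "mpoly_eval v 1 = 1"
  by (simp add: mpoly_eval_conv_line_eval)

lemma mpoly_eval_add: "mpoly_eval v (f + g) = mpoly_eval v f + mpoly_eval v g"
  by (simp add: mpoly_eval_conv_line_eval line_eval_add)

lemma mpoly_eval_mult: "mpoly_eval v (f * g) = mpoly_eval v f * mpoly_eval v g"
  by (simp add: mpoly_eval_conv_line_eval line_eval_mult)

lemma mpoly_eval_diff: "mpoly_eval v (f - g) = mpoly_eval v f - mpoly_eval v g"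
  using mpoly_eval_add[of v "f - g" g] by simp

lemma mpoly_eval_power: "mpoly_eval v (f ^ k) = mpoly_eval v f ^ k"
  by (simp add: mpoly_eval_conv_line_eval line_eval_power)

lemma mpoly_eval_prod: "mpoly_eval v (prod f A) = (\<Prod>x\<in>A. mpoly_eval v (f x))"
  by (induction A rule: infinite_finite_induct) (simp_all add: mpoly_eval_mult)

lemma homogeneous_iff: "homogeneous f \<longleftrightarrow> (\<exists>d. form_of_degree d f)"
  by (simp add: homogeneous_def form_of_degree_def)

lemma form_of_degree_single: "form_of_degree (monom_deg t) (Poly_Mapping.single t a)"
  by (simp add: form_of_degree_def)

lemma form_of_degree_var: "form_of_degree 1 (var i)"
  by (simp add: var_def form_of_degree_def)

lemma form_of_degree_diff:
  fixes f g :: "('n::finite, 'k::ab_group_add) mpoly"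
  assumes "form_of_degree d f" "form_of_degree d g"
  shows "form_of_degree d (f - g)"
  using assms by (auto simp: form_of_degree_def in_keys_iff lookup_minus)

lemma form_of_degree_mult:
  assumes "form_of_degree d f" "form_of_degree e g"
  shows "form_of_degree (d + e) (f * g)"
  using assms keys_mult[of f g] by (fastforce simp: form_of_degree_def monom_deg_add)

lemma form_of_degree_power:
  fixes f :: "('n::finite, 'k::comm_ring_1) mpoly"
  assumes "form_of_degree d f"
  shows "form_of_degree (k * d) (f ^ k)"
proof (induction k)
  case 0
  show ?case by (simp add: form_of_degree_def)
next
  case (Suc k)
  show ?case using form_of_degree_mult[OF assms Suc.IH] by simp
qed

lemma homogeneous_mult: "homogeneous f \<Longrightarrow> homogeneous g \<Longrightarrow> homogeneous (f * g)"
  using form_of_degree_mult by (fastforce simp: homogeneous_iff)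

lemma homogeneous_prod:
  fixes f :: "'a \<Rightarrow> ('n::finite, 'k::comm_ring_1) mpoly"
  assumes "\<And>x. x \<in> A \<Longrightarrow> homogeneous (f x)"
  shows "homogeneous (prod f A)"
  using assms
proof (induction A rule: infinite_finite_induct)
  case (insert x A)
  then show ?case by (simp add: homogeneous_mult)
qed (auto simp: homogeneous_def)

section \<open>Projective points and vanishing ideals\<close>

lemma proj_space_nonzero:
  assumes "P \<in> proj_space" "v \<in> P"
  shows "v \<noteq> 0"
  using in_quotient_imp_subset[OF equiv_proj_rel assms(1)[unfolded proj_space_def]] assms(2) by blast

text \<open>Scaling a vector multiplies the value of a form by a power of the scalar, so one
  representative decides.\<close>

lemma vanishes_at_class:
  assumes "homogeneous f" "v \<noteq> 0"
  shows "vanishes_at f (proj_rel `` {v}) \<longleftrightarrow> mpoly_eval v f = 0"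
proof
  assume "vanishes_at f (proj_rel `` {v})"
  moreover have "v \<in> proj_rel `` {v}"
    using equiv_class_self[OF equiv_proj_rel] \<open>v \<noteq> 0\<close> by blast
  ultimately show "mpoly_eval v f = 0"
    by (simp add: vanishes_at_def)
next
  assume 0: "mpoly_eval v f = 0"
  obtain d where d: "\<forall>t\<in>Poly_Mapping.keys f. monom_deg t = d"
    using assms(1) by (auto simp: homogeneous_def)
  show "vanishes_at f (proj_rel `` {v})"
    using 0 mpoly_eval_scale[OF d] by (auto simp: vanishes_at_def proj_rel_def)
qed

text \<open>A generator is a form with value 0 at \<open>v\<close>, so its restriction to the line
  is 0, and this passes to the generated ideal. Conversely, a polynomial that restricts to 0 on
  these lines is the sum of its homogeneous components, and each of them is itself a
  generator.\<close>

lemma mem_vanishing_ideal_iff: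
  "f \<in> vanishing_ideal X \<longleftrightarrow> (\<forall>P\<in>X. \<forall>v\<in>P. line_eval v f = 0)"
proof
  assume "f \<in> vanishing_ideal X"
  moreover have "vanishing_ideal X \<subseteq> {f. line_eval v f = 0}" if "P \<in> X" "v \<in> P" for P v
    unfolding vanishing_ideal_def
    by (rule ideal.span_minimal[OF _ subspace_line_eval_kernel])
      (use that in \<open>auto simp: homogeneous_iff line_eval_form vanishes_at_def\<close>)
  ultimately show "\<forall>P\<in>X. \<forall>v\<in>P. line_eval v f = 0"
    by blast
next
  assume f: "\<forall>P\<in>X. \<forall>v\<in>P. line_eval v f = 0"
  let ?K = "Poly_Mapping.keys f"
  \<comment> \<open>The homogeneous component of \<open>f\<close> of degree
    \<open>d\<close>.\<close>
  define c where "c d = (\<Sum>t\<in>{t\<in>?K. monom_deg t = d}.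
    Poly_Mapping.single t (Poly_Mapping.lookup f t))" for d
  have lookup_c: "Poly_Mapping.lookup (c d) t = (if monom_deg t = d then Poly_Mapping.lookup f t else 0)" for d t
    by (auto simp: c_def lookup_sum lookup_single when_def in_keys_iff sum.delta)
  have form_c: "form_of_degree d (c d)" for d
    by (auto simp: form_of_degree_def in_keys_iff lookup_c split: if_splits)
  have f_eq: "f = (\<Sum>d\<in>monom_deg ` ?K. c d)"
    unfolding c_def by (subst sum.group) (simp_all add: poly_mapping_sum_single)
  have "c d \<in> vanishing_ideal X" for d
    unfolding vanishing_ideal_def
  proof (rule ideal.span_base, intro CollectI conjI ballI)
    show "homogeneous (c d)"
      using form_c homogeneous_iff by blast
    fix P assume "P \<in> X"
    have "mpoly_eval v (c d) = 0" if "v \<in> P" for v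
    proof -
      \<comment> \<open>The component of degree \<open>e\<close> contributes only to the coefficient
        of T^e, so the coefficient of T^d is the value of \<open>c d\<close> alone.\<close>
      have "coeff (line_eval v f) d = (\<Sum>e\<in>monom_deg ` ?K. if e = d then mpoly_eval v (c e) else 0)"
        by (subst f_eq) (simp add: line_eval_sum line_eval_form[OF form_c] coeff_sum)
      also have "\<dots> = (if d \<in> monom_deg ` ?K then mpoly_eval v (c d) else 0)"
        by simp
      finally have "d \<in> monom_deg ` ?K \<Longrightarrow> mpoly_eval v (c d) = 0"
        using f that \<open>P \<in> X\<close> by simp
      moreover have "c d = 0" if "d \<notin> monom_deg ` ?K"
      proof -
        have "{t \<in> ?K. monom_deg t = d} = {}" using that by auto
        then show ?thesis by (simp only: c_def sum.empty)
      qed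
      ultimately show ?thesis
        by (cases "d \<in> monom_deg ` ?K") (auto simp: mpoly_eval_def)
    qed
    then show "vanishes_at (c d) P"
      by (simp add: vanishes_at_def)
  qed
  then have "(\<Sum>d\<in>monom_deg ` ?K. c d) \<in> vanishing_ideal X"
    unfolding vanishing_ideal_def by (rule ideal.span_sum)
  then show "f \<in> vanishing_ideal X"
    by (simp only: f_eq[symmetric])
qed

section \<open>Sums, colons and powers of ideals\<close>

lemma subspace_set_plus:
  assumes "is_ideal A" "is_ideal B"
  shows "is_ideal (A + B)"
proof (rule ideal.subspaceI)
  have "0 + 0 \<in> A + B"
    using assms by (intro set_plus_intro ideal.subspace_0)
  then show "0 \<in> A + B"
    by simp
next
  fix x y assume "x \<in> A + B" "y \<in> A + B"
  then obtain a b a' b' where ab: "a \<in> A" "b \<in> B" "a' \<in> A" "b' \<in> B"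
    and xy: "x = a + b" "y = a' + b'"
    unfolding set_plus_def by blast
  have eq: "x + y = (a + a') + (b + b')"
    using xy by (simp add: algebra_simps)
  show "x + y \<in> A + B"
    unfolding eq by (intro set_plus_intro ideal.subspace_add assms ab)
next
  fix c x assume "x \<in> A + B"
  then obtain a b where ab: "a \<in> A" "b \<in> B" and x: "x = a + b"
    unfolding set_plus_def by blast
  show "c * x \<in> A + B"
    unfolding x distrib_left by (intro set_plus_intro ideal.subspace_scale assms ab)
qed

lemma subspace_ideal_colon:
  assumes "is_ideal A"
  shows "is_ideal (ideal_colon A B)"
proof (rule ideal.subspaceI)
  show "0 \<in> ideal_colon A B"
    using ideal.subspace_0[OF assms] by (simp add: ideal_colon_def)
  show "f + g \<in> ideal_colon A B" if "f \<in> ideal_colon A B" "g \<in> ideal_colon A B" for f g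
    using that ideal.subspace_add[OF assms]
    unfolding ideal_colon_def mem_Collect_eq distrib_right by blast
  show "c * f \<in> ideal_colon A B" if "f \<in> ideal_colon A B" for c f
    using that ideal.subspace_scale[OF assms]
    unfolding ideal_colon_def mem_Collect_eq mult.assoc by blast
qed

lemma power_mem_ideal_power:
  assumes "a \<in> B"
  shows "a ^ k \<in> ideal_power B k"
proof (induction k)
  case (Suc k)
  with assms show ?case
    by (auto intro!: ideal.span_base)
qed simp

text \<open>The polynomials without terms of degree below \<open>k\<close> form an ideal
  \<open>?D k\<close>. The variables lie in \<open>?D 1\<close>, and orders add under
  multiplication, so induction on \<open>k\<close> applies.\<close>

lemma max_ideal_power_monom_deg:
  fixes b :: "('n::finite, 'k::comm_ring_1) mpoly"
  assumes "b \<in> ideal_power max_ideal k" "t \<in> Poly_Mapping.keys b"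
  shows "k \<le> monom_deg t"
proof -
  let ?D = "\<lambda>k. {b :: ('n, 'k) mpoly. \<forall>t\<in>Poly_Mapping.keys b. k \<le> monom_deg t}"
  have mult: "a * b \<in> ?D (i + j)" if "a \<in> ?D i" "b \<in> ?D j" for a b i j
  proof (intro CollectI ballI)
    fix t assume "t \<in> Poly_Mapping.keys (a * b)"
    then obtain u w where "t = u + w" "u \<in> Poly_Mapping.keys a" "w \<in> Poly_Mapping.keys b"
      using keys_mult[of a b] by blast
    with that show "i + j \<le> monom_deg t"
      by (simp add: monom_deg_add add_mono)
  qed
  have ideal: "is_ideal (?D k)" for k
  proof (rule ideal.subspaceI)
    show "a + b \<in> ?D k" if "a \<in> ?D k" "b \<in> ?D k" for a b
      using that keys_add[of a b] by blast
    show "c * b \<in> ?D k" if "b \<in> ?D k" for c b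
      \<comment> \<open>Every polynomial lies in \<open>?D 0\<close>, so the product rule with order
        0 gives closure under arbitrary multiples.\<close>
      using mult[of c 0 b k] that by simp
  qed simp
  have max: "max_ideal \<subseteq> ?D 1"
    unfolding max_ideal_def by (rule ideal.span_minimal[OF _ ideal]) (auto simp: var_def)
  have "ideal_power max_ideal k \<subseteq> ?D k"
  proof (induction k)
    case (Suc k)
    have "{a * b | a b. a \<in> max_ideal \<and> b \<in> ideal_power max_ideal k} \<subseteq> ?D (Suc k)"
      using mult[of _ 1 _ k] max Suc.IH by fastforce
    then show ?case
      unfolding ideal_power.simps by (rule ideal.span_minimal[OF _ ideal])
  qed simp
  with assms show ?thesis by blast
qed

section \<open>Forms that separate rational points\<close>

lemma point_separating_form:
  fixes v :: "'k::{field, finite} ^ 'n::finite"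
  assumes "v \<noteq> 0"
  obtains f where "homogeneous f" "mpoly_eval v f \<noteq> 0"
    "\<And>w. (\<nexists>a. w = a *s v) \<Longrightarrow> mpoly_eval w f = 0"
proof -
  obtain i where i: "v $ i \<noteq> 0"
    using assms by (auto simp: vec_eq_iff)
  define l :: "'n \<Rightarrow> 'k \<Rightarrow> ('n, 'k) mpoly"
    where "l j c = var j - Poly_Mapping.single (Poly_Mapping.single i 1) c" for j c
  \<comment> \<open>Finiteness of the field makes this a polynomial. At \<open>v\<close> no factor
    vanishes, since the ratio of the coordinates j and i of \<open>v\<close> is left out. The factor
    \<open>var i\<close> kills the vectors whose i-th coordinate is 0; any other \<open>w\<close>
    off the line of \<open>v\<close> has some ratio different from that of \<open>v\<close>, and the
    corresponding factor vanishes at \<open>w\<close>.\<close>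
  define f where "f = var i * (\<Prod>j\<in>UNIV. \<Prod>c\<in>UNIV - {v $ j / v $ i}. l j c)"
  have eval_l: "mpoly_eval w (l j c) = w $ j - c * w $ i" for w j c
    by (simp add: l_def mpoly_eval_diff)
  have form_l: "form_of_degree 1 (l j c)" for j c
    unfolding l_def
    using form_of_degree_single[of "Poly_Mapping.single i 1" c]
    by (intro form_of_degree_diff form_of_degree_var) simp
  have eval_f: "mpoly_eval w f = w $ i * (\<Prod>j\<in>UNIV. \<Prod>c\<in>UNIV - {v $ j / v $ i}. w $ j - c * w $ i)" for w
    by (simp add: f_def mpoly_eval_mult mpoly_eval_prod eval_l)
  show thesis
  proof (rule that[of f])
    show "homogeneous f"
      unfolding f_def
      by (intro homogeneous_mult homogeneous_prod) (use form_l form_of_degree_var homogeneous_iff in blast)+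
    show "mpoly_eval v f \<noteq> 0"
      using i by (auto simp: eval_f field_simps)
  next
    fix w assume w: "\<nexists>a. w = a *s v"
    show "mpoly_eval w f = 0"
    proof (cases "w $ i = 0")
      case False
      have "w \<noteq> (w $ i / v $ i) *s v"
        using w by blast
      then obtain j where j: "w $ j \<noteq> w $ i / v $ i * v $ j"
        by (auto simp: vec_eq_iff)
      then have "w $ j / w $ i \<in> UNIV - {v $ j / v $ i}"
        using False i by (auto simp: field_simps)
      moreover have "w $ j - w $ j / w $ i * w $ i = 0"
        using False by simp
      ultimately have "(\<Prod>c\<in>UNIV - {v $ j / v $ i}. w $ j - c * w $ i) = 0"
        by (intro prod_zero bexI[of _ "w $ j / w $ i"]) simp_all
      then have "(\<Prod>j\<in>UNIV. \<Prod>c\<in>UNIV - {v $ j / v $ i}. w $ j - c * w $ i) = 0"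
        by (intro prod_zero) auto
      then show ?thesis
        by (simp add: eval_f)
    qed (simp add: eval_f)
  qed
qed

text \<open>Multiplying a separating form \<open>h\<close> by \<open>g\<close> puts it into
  \<open>I\<close> without losing the separation, because \<open>g\<close> does not vanish at
  \<open>v\<close>.\<close>

lemma eventually_point_separating_form_in_ideal:
  fixes I :: "('n::finite, 'k::{field, finite}) mpoly set"
  assumes "is_ideal I" "g \<in> I" "homogeneous g" "v \<noteq> 0" "mpoly_eval v g \<noteq> 0"
  shows "\<forall>\<^sub>F e in sequentially. \<exists>f\<in>I. form_of_degree e f \<and> mpoly_eval v f \<noteq> 0 \<and>
           (\<forall>w. (\<nexists>a. w = a *s v) \<longrightarrow> mpoly_eval w f = 0)"
proof -
  obtain h where h: "homogeneous h" "mpoly_eval v h \<noteq> 0"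
    "\<And>w. (\<nexists>a. w = a *s v) \<Longrightarrow> mpoly_eval w h = 0"
    using point_separating_form[OF \<open>v \<noteq> 0\<close>] by blast
  obtain d where d: "form_of_degree d (h * g)"
    using h(1) assms(3) homogeneous_mult homogeneous_iff by blast
  obtain i where i: "v $ i \<noteq> 0"
    using \<open>v \<noteq> 0\<close> by (auto simp: vec_eq_iff)
  show ?thesis
    unfolding eventually_sequentially
  proof (intro exI[of _ d] allI impI bexI conjI)
    fix e assume "d \<le> e"
    \<comment> \<open>The power of a variable that is nonzero at \<open>v\<close> raises the degree
      from \<open>d\<close> to exactly \<open>e\<close>.\<close>
    let ?f = "var i ^ (e - d) * (h * g)"
    show "?f \<in> I"
      using assms(1,2) by (intro ideal.subspace_scale)
    show "form_of_degree e ?f"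
      using form_of_degree_mult[OF form_of_degree_power[OF form_of_degree_var, of "e - d"] d] \<open>d \<le> e\<close>
      by simp
    show "mpoly_eval v ?f \<noteq> 0"
      using i h(2) assms(5) by (simp add: mpoly_eval_mult mpoly_eval_power)
    fix w assume "\<nexists>a. w = a *s v"
    then show "mpoly_eval w ?f = 0"
      using h(3) by (simp add: mpoly_eval_mult)
  qed
qed

text \<open>The finitely many vectors outside the zero set have a common degree threshold. Beyond
  it, a form is corrected at one such vector after another by elements of \<open>I\<close>, until it
  vanishes at every rational point.\<close>

lemma eventually_forms_vanishing_on_proj_zeros:
  fixes I :: "('n::finite, 'k::{field, finite}) mpoly set"
  assumes "is_ideal I"
  shows "\<forall>\<^sub>F e in sequentially. \<forall>g. form_of_degree e g \<and> (\<forall>P\<in>proj_zeros I. vanishes_at g P) \<longrightarrow>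
           g \<in> I + vanishing_ideal proj_space"
proof -
  \<comment> \<open>Vectors are used instead of points. Several of them may represent one point,
    which does no harm.\<close>
  let ?U = "{v. v \<noteq> 0 \<and> proj_rel `` {v} \<notin> proj_zeros I}"
  let ?sep = "\<lambda>e v. \<exists>f\<in>I. form_of_degree e f \<and> mpoly_eval v f \<noteq> 0 \<and>
    (\<forall>w. (\<nexists>a. w = a *s v) \<longrightarrow> mpoly_eval w f = 0)"
  have cls: "proj_rel `` {v} \<in> proj_space" if "v \<noteq> 0" for v :: "'k ^ 'n"
    using that by (auto simp: proj_space_def intro: quotientI)
  have J: "is_ideal (I + vanishing_ideal proj_space)"
    unfolding vanishing_ideal_def by (intro subspace_set_plus assms ideal.subspace_span)
  have "\<forall>\<^sub>F e in sequentially. ?sep e v" if v: "v \<in> ?U" for v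
  proof -
    obtain g where "g \<in> I" "homogeneous g" "\<not> vanishes_at g (proj_rel `` {v})"
      using v cls by (auto simp: proj_zeros_def)
    then show ?thesis
      using v vanishes_at_class
      by (intro eventually_point_separating_form_in_ideal[OF assms]) auto
  qed
  then have "\<forall>\<^sub>F e in sequentially. \<forall>v\<in>?U. ?sep e v"
    by (intro eventually_ball_finite) auto
  then show ?thesis
  proof (rule eventually_mono, intro allI impI)
    fix e and g :: "('n, 'k) mpoly"
    assume sep: "\<forall>v\<in>?U. ?sep e v"
      and g: "form_of_degree e g \<and> (\<forall>P\<in>proj_zeros I. vanishes_at g P)"
    \<comment> \<open>\<open>Y\<close> contains all nonzero vectors at which the value of
      \<open>g\<close> may still be nonzero.\<close>
    have "g \<in> I + vanishing_ideal proj_space"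
      if "finite Y" "Y \<subseteq> ?U" "form_of_degree e g" "\<And>w. w \<noteq> 0 \<Longrightarrow> w \<notin> Y \<Longrightarrow> mpoly_eval w g = 0"
      for Y g
      using that
    proof (induction Y arbitrary: g)
      case empty
      have "vanishes_at g P" if "P \<in> proj_space" for P
        using proj_space_nonzero[OF that] empty.prems(3) by (auto simp: vanishes_at_def)
      moreover have "homogeneous g"
        using empty.prems(2) homogeneous_iff by blast
      ultimately have "g \<in> vanishing_ideal proj_space"
        by (auto simp: vanishing_ideal_def intro: ideal.span_base)
      moreover have "0 \<in> I"
        using assms by (rule ideal.subspace_0)
      ultimately show ?case
        by (metis add_0 set_plus_intro)
    next
      case (insert v Y)
      obtain f where f: "f \<in> I" "form_of_degree e f" "mpoly_eval v f \<noteq> 0"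
        "\<And>w. (\<nexists>a. w = a *s v) \<Longrightarrow> mpoly_eval w f = 0"
        using sep insert.prems(1) by blast
      \<comment> \<open>The constant is chosen so that \<open>?h\<close> and \<open>g\<close> have
        the same value at \<open>v\<close>.\<close>
      let ?h = "Poly_Mapping.single 0 (mpoly_eval v g / mpoly_eval v f) * f"
      have hJ: "?h \<in> I + vanishing_ideal proj_space"
      proof -
        have "?h \<in> I"
          using assms f(1) by (rule ideal.subspace_scale)
        moreover have "0 \<in> vanishing_ideal proj_space"
          by (simp add: vanishing_ideal_def ideal.span_zero)
        ultimately show ?thesis
          by (metis add.right_neutral set_plus_intro)
      qed
      have form: "form_of_degree e (g - ?h)"
        using form_of_degree_mult[OF form_of_degree_single[of 0] f(2)] insert.prems(2)
        by (intro form_of_degree_diff) simp_all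
      have "g - ?h \<in> I + vanishing_ideal proj_space"
      proof (rule insert.IH)
        fix w :: "'k ^ 'n" assume w: "w \<noteq> 0" "w \<notin> Y"
        show "mpoly_eval w (g - ?h) = 0"
        proof (cases "\<exists>a. w = a *s v")
          case True
          then obtain a where "w = a *s v" by blast
          moreover have "mpoly_eval v (g - ?h) = 0"
            using f(3) by (simp add: mpoly_eval_diff mpoly_eval_mult)
          ultimately show ?thesis
            using mpoly_eval_scale[OF form[unfolded form_of_degree_def]] by simp
        next
          case False
          then have "w \<noteq> v" using vector_smult_lid[of v] by metis
          then show ?thesis
            using f(4)[OF False] insert.prems(3) w by (simp add: mpoly_eval_diff mpoly_eval_mult)
        qed
      qed (use insert.prems form in auto)
      then show ?case
        using ideal.subspace_add[OF J _ hJ] by fastforce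
    qed
    \<comment> \<open>A nonzero vector outside \<open>?U\<close> represents a point of
      \<open>proj_zeros I\<close>, where \<open>g\<close> vanishes.\<close>
    from this[of ?U g] show "g \<in> I + vanishing_ideal proj_space"
      using g vanishes_at_class[of g] homogeneous_iff by auto
  qed
qed

section \<open>The two inclusions of the saturation formula\<close>

theorem theorem2p10:
  fixes I :: "('n::finite, 'k::{field, finite}) mpoly set"
    and X :: "('k ^ 'n) set set"
  assumes "homogeneous_ideal I"
    and "ideal_colon (vanishing_ideal proj_space) I \<noteq> vanishing_ideal proj_space"
    and "X = proj_zeros I"
  shows "vanishing_ideal X = saturation (I + vanishing_ideal proj_space) max_ideal"
proof -
  let ?J = "I + vanishing_ideal proj_space"
  obtain G where G: "\<forall>g\<in>G. homogeneous g" "I = ideal_gen G" and I: "is_ideal I"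
    using assms(1) by (auto simp: homogeneous_ideal_def)
  have J: "is_ideal ?J"
    unfolding vanishing_ideal_def by (intro subspace_set_plus I ideal.subspace_span)
  show ?thesis
  proof (intro equalityI subsetI)
    fix f assume "f \<in> saturation ?J max_ideal"
    then obtain k where k: "\<And>b. b \<in> ideal_power max_ideal k \<Longrightarrow> f * b \<in> ?J"
      by (auto simp: saturation_def ideal_colon_def)
    show "f \<in> vanishing_ideal X"
      unfolding mem_vanishing_ideal_iff
    proof (intro ballI)
      fix P v assume Pv: "P \<in> X" "v \<in> P"
      then have P: "P \<in> proj_space"
        by (simp add: assms(3) proj_zeros_def)
      let ?Z = "{f. line_eval v f = 0}"
      \<comment> \<open>The definition of \<open>proj_zeros\<close> tests only homogeneous elements
        of \<open>I\<close>, so the argument passes through homogeneous generators.\<close>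
      have "G \<subseteq> ?Z"
        using G Pv ideal.span_base[of _ G]
        by (fastforce simp: assms(3) proj_zeros_def vanishes_at_def homogeneous_iff line_eval_form)
      then have "I \<subseteq> ?Z"
        unfolding G(2) by (rule ideal.span_minimal[OF _ subspace_line_eval_kernel])
      moreover have "vanishing_ideal proj_space \<subseteq> ?Z"
        using P Pv(2) mem_vanishing_ideal_iff by blast
      ultimately have JZ: "?J \<subseteq> ?Z"
        using ideal.subspace_add[OF subspace_line_eval_kernel] by (blast elim: set_plus_elim)
      obtain i where i: "v $ i \<noteq> 0"
        using proj_space_nonzero[OF P Pv(2)] by (auto simp: vec_eq_iff)
      have "(var i :: ('n, 'k) mpoly) \<in> max_ideal"
        by (simp add: max_ideal_def ideal.span_base)
      \<comment> \<open>The restriction of \<open>var i ^ k\<close> is the k-th power of a nonzero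
        element of the domain \<open>'k poly\<close> and can be cancelled.\<close>
      then have "line_eval v (f * var i ^ k) = 0"
        using k JZ power_mem_ideal_power by blast
      moreover have "line_eval v (var i) \<noteq> 0"
        using i by (simp add: var_def)
      ultimately show "line_eval v f = 0"
        by (simp add: line_eval_mult line_eval_power)
    qed
  next
    fix f assume f: "f \<in> vanishing_ideal X"
    obtain k where k: "\<And>e g. k \<le> e \<Longrightarrow> form_of_degree e g \<Longrightarrow> \<forall>P\<in>X. vanishes_at g P \<Longrightarrow> g \<in> ?J"
      using eventually_forms_vanishing_on_proj_zeros[OF I]
      unfolding eventually_sequentially assms(3) by blast
    \<comment> \<open>The exponent \<open>Suc k\<close> is positive, as \<open>saturation\<close>
      demands, even if the threshold \<open>k\<close> is 0.\<close>
    have "g * b \<in> ?J"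
      if g: "homogeneous g" "\<forall>P\<in>X. vanishes_at g P" and b: "b \<in> ideal_power max_ideal (Suc k)" for g b
    proof -
      obtain d where d: "form_of_degree d g"
        using g(1) homogeneous_iff by blast
      \<comment> \<open>Since \<open>b\<close> need not be homogeneous, it is split into terms. Each
        has degree above \<open>k\<close>, so its product with \<open>g\<close> is a form of large
        degree that vanishes on \<open>X\<close>.\<close>
      have "g * Poly_Mapping.single t (Poly_Mapping.lookup b t) \<in> ?J" if "t \<in> Poly_Mapping.keys b" for t
      proof (rule k)
        show "form_of_degree (d + monom_deg t) (g * Poly_Mapping.single t (Poly_Mapping.lookup b t))"
          using d form_of_degree_single by (rule form_of_degree_mult)
        show "k \<le> d + monom_deg t"
          using max_ideal_power_monom_deg[OF b that] by simp
      qed (use g(2) in \<open>simp add: vanishes_at_def mpoly_eval_mult\<close>)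
      then have "(\<Sum>t\<in>Poly_Mapping.keys b. g * Poly_Mapping.single t (Poly_Mapping.lookup b t)) \<in> ?J"
        by (rule ideal.subspace_sum[OF J])
      then show ?thesis
        by (simp add: sum_distrib_left[symmetric] poly_mapping_sum_single)
    qed
    \<comment> \<open>The colon is an ideal, so checking the homogeneous generators of the vanishing
      ideal suffices. One exponent serves them all.\<close>
    then have "vanishing_ideal X \<subseteq> ideal_colon ?J (ideal_power max_ideal (Suc k))"
      unfolding vanishing_ideal_def[of X]
      by (intro ideal.span_minimal subspace_ideal_colon J) (auto simp: ideal_colon_def)
    then show "f \<in> saturation ?J max_ideal"
      using f unfolding saturation_def by fastforce
  qed
qed

end
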